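(* Fix an integer $y \ge 1$ and let $$\mathcal{D}_y = \{(x, C) \in \mathbb{N}^2 : x > y \log_2 3,\ C \ge 1,\ (2^x - 3^y) \mid C\}.$$ Then $\mathcal{D}_y$ is not a semilinear subset of $\mathbb{N}^2$ (equivalently, it is not definable in Presburger arithmetic).
   Context: A set $L \subseteq \mathbb{N}^d$ is linear if $L = \{b + \sum_{i=1}^k \lambda_i v_i : \lambda_i \in \mathbb{N}\}$ for some $b \in \mathbb{N}^d$ and finitely many $v_1,\ldots,v_k \in \mathbb{N}^d$; it is semilinear if it is a finite union of linear sets. Presburger arithmetic is the first-order theory of $(\mathbb{N}, +, <, 0, 1)$. *)

theory Defs
  imports "HOL-Analysis.Analysis"
begin

definition linear_set :: "(nat ^ 'd::finite) set \<Rightarrow> bool" where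
  "linear_set L \<longleftrightarrow>
     (\<exists>(b :: nat ^ 'd) (k :: nat) (v :: nat \<Rightarrow> nat ^ 'd).
        L = {b + (\<Sum>i = 1..k. c i *s v i) | c :: nat \<Rightarrow> nat. True})"

definition semilinear_set :: "(nat ^ 'd::finite) set \<Rightarrow> bool" where
  "semilinear_set S \<longleftrightarrow>
     (\<exists>\<L>. finite \<L> \<and> (\<forall>L\<in>\<L>. linear_set L) \<and> S = \<Union>\<L>)"

text \<open>First-order logic with equality over the signature \<open>(+, <, 0, 1)\<close>, with variables
  named by natural numbers, interpreted in the natural numbers.\<close>

datatype pterm = Var nat | Zero | One | Plus pterm pterm

datatype pform =
    Eq pterm pterm
  | Less pterm pterm
  | Neg pform
  | Conj pform pform
  | Disj pform pform
  | Impl pform pform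
  | Exists nat pform
  | Forall nat pform

primrec tvars :: "pterm \<Rightarrow> nat set" where
  "tvars (Var n) = {n}"
| "tvars Zero = {}"
| "tvars One = {}"
| "tvars (Plus s t) = tvars s \<union> tvars t"

primrec free_vars :: "pform \<Rightarrow> nat set" where
  "free_vars (Eq s t) = tvars s \<union> tvars t"
| "free_vars (Less s t) = tvars s \<union> tvars t"
| "free_vars (Neg p) = free_vars p"
| "free_vars (Conj p q) = free_vars p \<union> free_vars q"
| "free_vars (Disj p q) = free_vars p \<union> free_vars q"
| "free_vars (Impl p q) = free_vars p \<union> free_vars q"
| "free_vars (Exists n p) = free_vars p - {n}"
| "free_vars (Forall n p) = free_vars p - {n}"

primrec tval :: "(nat \<Rightarrow> nat) \<Rightarrow> pterm \<Rightarrow> nat" where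
  "tval e (Var n) = e n"
| "tval e Zero = 0"
| "tval e One = 1"
| "tval e (Plus s t) = tval e s + tval e t"

primrec sat :: "(nat \<Rightarrow> nat) \<Rightarrow> pform \<Rightarrow> bool" where
  "sat e (Eq s t) \<longleftrightarrow> tval e s = tval e t"
| "sat e (Less s t) \<longleftrightarrow> tval e s < tval e t"
| "sat e (Neg p) \<longleftrightarrow> \<not> sat e p"
| "sat e (Conj p q) \<longleftrightarrow> sat e p \<and> sat e q"
| "sat e (Disj p q) \<longleftrightarrow> sat e p \<or> sat e q"
| "sat e (Impl p q) \<longleftrightarrow> (sat e p \<longrightarrow> sat e q)"
| "sat e (Exists n p) \<longleftrightarrow> (\<exists>a. sat (e(n := a)) p)"
| "sat e (Forall n p) \<longleftrightarrow> (\<forall>a. sat (e(n := a)) p)"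

text \<open>The injection \<open>x\<close> names the free variable that stands for each coordinate; since all free
  variables of \<open>p\<close> are of this form, the values of \<open>e\<close> elsewhere do not matter.\<close>

definition presburger_definable :: "(nat ^ 'd::finite) set \<Rightarrow> bool" where
  "presburger_definable S \<longleftrightarrow>
     (\<exists>(p :: pform) (x :: 'd \<Rightarrow> nat). inj x \<and> free_vars p \<subseteq> range x \<and>
        (\<forall>(a :: nat ^ 'd) e. (\<forall>i. e (x i) = a $ i) \<longrightarrow> (a \<in> S \<longleftrightarrow> sat e p)))"

definition D :: "nat \<Rightarrow> (nat ^ 2) set" where
  "D y = {vector [x, C] | x C :: nat.
            real x > real y * log 2 3 \<and> C \<ge> 1 \<and> (2 ^ x - 3 ^ y :: int) dvd int C}"

end

theory Submission
  imports
    "HOL-Decision_Procs.Cooper"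
    "HOL-Real_Asymp.Real_Asymp"
    Defs
begin

text \<open>Call a set \<open>S \<subseteq> \<nat>\<^sup>2\<close> fibre periodic if there are a period \<open>M > 0\<close> and a slope \<open>K\<close> such that, above
  the line \<open>c = K (x + 1)\<close>, each vertical fibre of \<open>S\<close> is stable under adding multiples of \<open>M\<close>.
  A point of a linear set far above the line must use a vertical generator, which serves
  as a period. A Presburger formula is equivalent, by Cooper's quantifier elimination, to a
  Boolean combination of linear inequalities, whose truth value is constant on fibres above a suitable line,
  and divisibility conditions, which are periodic. So semilinear and Presburger definable sets are
  fibre periodic. But the least element of the fibre of \<open>D y\<close> over \<open>x\<close> is \<open>2\<^sup>x - 3\<^sup>y\<close>, which for
  large \<open>x\<close> lies above every line, and stability under \<open>M\<close> would force \<open>2\<^sup>x - 3\<^sup>y\<close> to divide \<open>M\<close>.\<close>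

definition fibre_periodic :: "(nat ^ 2) set \<Rightarrow> bool" where
  "fibre_periodic S \<longleftrightarrow> (\<exists>M>0. \<exists>K. \<forall>x c m. M dvd m \<longrightarrow> K * (x + 1) < c \<longrightarrow>
     vector [x, c] \<in> S \<longrightarrow> vector [x, c + m] \<in> S)"

section \<open>Semilinear sets\<close>

text \<open>The product of the periods is a common period and the sum of the slopes dominates both.
  Quantifying over all multiples of the period makes passing to a common one immediate.\<close>

lemma fibre_periodic_Un:
  assumes "fibre_periodic S" "fibre_periodic T'"
  shows "fibre_periodic (S \<union> T')"
proof -
  obtain M K where M: "M > 0" and S: "\<And>x c m. M dvd m \<Longrightarrow> K * (x + 1) < c \<Longrightarrow>
      vector [x, c] \<in> S \<Longrightarrow> vector [x, c + m] \<in> S"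
    using assms(1) unfolding fibre_periodic_def by blast
  obtain M' K' where M': "M' > 0" and T': "\<And>x c m. M' dvd m \<Longrightarrow> K' * (x + 1) < c \<Longrightarrow>
      vector [x, c] \<in> T' \<Longrightarrow> vector [x, c + m] \<in> T'"
    using assms(2) unfolding fibre_periodic_def by blast
  have "vector [x, c + m] \<in> S \<union> T'"
    if "M * M' dvd m" "(K + K') * (x + 1) < c" "vector [x, c] \<in> S \<union> T'" for x c m
  proof -
    have "M dvd m" "M' dvd m"
      using that(1) by (auto dest: dvd_mult_left dvd_mult_right)
    moreover have "K * (x + 1) < c" "K' * (x + 1) < c"
      using that(2) by (auto simp: algebra_simps)
    ultimately show ?thesis
      using S T' that(3) by blast
  qed
  then show ?thesis
    unfolding fibre_periodic_def using M M'
    by (intro exI[of _ "M * M'"] exI[of _ "K + K'"] conjI) auto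
qed

text \<open>A vertical generator can be repeated at will, so its height is a period. Without one,
  each generator that gains height also moves right, so its coefficient is at most \<open>x\<close>
  and the whole set lies on or below a line.\<close>

lemma fibre_periodic_linear_set:
  fixes L :: "(nat ^ 2) set"
  assumes "linear_set L"
  shows "fibre_periodic L"
proof -
  obtain b k v where L: "L = {b + (\<Sum>i = 1..k. l i *s v i) | l :: nat \<Rightarrow> nat. True}"
    using assms unfolding linear_set_def by blast
  show ?thesis
  proof (cases "\<exists>i\<in>{1..k}. v i $ 1 = 0 \<and> v i $ 2 > 0")
    case True
    then obtain i where i: "i \<in> {1..k}" "v i $ 1 = 0" "v i $ 2 > 0"
      by blast
    have "vector [x, c + m] \<in> L" if m: "v i $ 2 dvd m" and xc: "vector [x, c] \<in> L" for x c m
    proof -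
      obtain l where l: "vector [x, c] = b + (\<Sum>j = 1..k. l j *s v j)"
        using xc L by blast
      obtain q where q: "m = v i $ 2 * q"
        using m by blast
      \<comment> \<open>\<open>q\<close> further copies of the vertical generator raise the point by
        \<open>m\<close>.\<close>
      define l' where "l' = l(i := l i + q)"
      have "(\<Sum>j = 1..k. l' j *s v j) = (\<Sum>j = 1..k. l j *s v j + (if j = i then q *s v i else 0))"
        by (intro sum.cong) (auto simp: l'_def vec_eq_iff algebra_simps)
      also have "\<dots> = (\<Sum>j = 1..k. l j *s v j) + q *s v i"
        using i(1) by (simp add: sum.distrib)
      finally have "b + (\<Sum>j = 1..k. l' j *s v j) = vector [x, c] + q *s v i"
        using l by (simp add: add.assoc)
      also have "\<dots> = vector [x, c + m]"
        using i(2) q by (simp add: vec_eq_iff forall_2)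
      finally show ?thesis
        unfolding L by (auto intro: sym)
    qed
    then show ?thesis
      unfolding fibre_periodic_def using i(3) by blast
  next
    case False
    \<comment> \<open>When the coefficients of all generators of nonzero height are at most
      \<open>x\<close>, the height is at most \<open>b $ 2\<close> plus \<open>x\<close> times the
      sum of the generators' heights.\<close>
    define K where "K = b $ 2 + (\<Sum>i = 1..k. v i $ 2)"
    have "c \<le> K * (x + 1)" if xc: "vector [x, c] \<in> L" for x c
    proof -
      obtain l where l: "vector [x, c] = b + (\<Sum>j = 1..k. l j *s v j)"
        using xc L by blast
      have x: "x = b $ 1 + (\<Sum>j = 1..k. l j * v j $ 1)"
        using arg_cong[OF l, of "\<lambda>u. u $ 1"] by simp
      have c: "c = b $ 2 + (\<Sum>j = 1..k. l j * v j $ 2)"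
        using arg_cong[OF l, of "\<lambda>u. u $ 2"] by simp
      have "l j * v j $ 2 \<le> x * v j $ 2" if j: "j \<in> {1..k}" for j
      proof (cases "v j $ 2 = 0")
        case False
        then have "v j $ 1 \<noteq> 0"
          using \<open>\<not> (\<exists>i\<in>{1..k}. v i $ 1 = 0 \<and> v i $ 2 > 0)\<close> j by auto
        then have "l j \<le> l j * v j $ 1"
          by simp
        also have "\<dots> \<le> (\<Sum>j = 1..k. l j * v j $ 1)"
          using j by (intro member_le_sum) auto
        also have "\<dots> \<le> x"
          using x by simp
        finally show ?thesis
          by simp
      qed simp
      then have "c \<le> b $ 2 + (\<Sum>j = 1..k. x * v j $ 2)"
        unfolding c by (intro add_left_mono sum_mono) auto
      also have "\<dots> \<le> K * (x + 1)"
        by (simp add: K_def sum_distrib_left[symmetric] algebra_simps)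
      finally show ?thesis .
    qed
    \<comment> \<open>No point lies above the line, so the condition is vacuous and the period 1
      will do.\<close>
    then have "\<forall>x c m. 1 dvd m \<longrightarrow> K * (x + 1) < c \<longrightarrow>
        vector [x, c] \<in> L \<longrightarrow> vector [x, c + m] \<in> L"
      by (meson not_le)
    then show ?thesis
      unfolding fibre_periodic_def by (intro exI[of _ 1] exI[of _ K] conjI) auto
  qed
qed

lemma fibre_periodic_semilinear_set:
  fixes S :: "(nat ^ 2) set"
  assumes "semilinear_set S"
  shows "fibre_periodic S"
proof -
  obtain \<L> where "finite \<L>" "\<forall>L\<in>\<L>. linear_set L" "S = \<Union>\<L>"
    using assms unfolding semilinear_set_def by blast
  moreover from this(1,2) have "fibre_periodic (\<Union>\<L>)"
  proof (induction \<L>)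
    case empty
    show ?case
      unfolding fibre_periodic_def by auto
  next
    case (insert L \<L>)
    then show ?case
      by (simp add: fibre_periodic_Un fibre_periodic_linear_set)
  qed
  ultimately show ?thesis
    by simp
qed

section \<open>Quantifier-free formulas\<close>

text \<open>Cooper's formulas are interpreted in the integers, and equality in place of implication
  gives closure under negation. \<open>m \<ge> 0\<close> keeps \<open>c + m\<close> above the line;
  \<open>K \<ge> 0\<close> lets slopes be added.\<close>

definition fibre_periodic_pred :: "(int \<Rightarrow> int \<Rightarrow> bool) \<Rightarrow> bool" where
  "fibre_periodic_pred P \<longleftrightarrow> (\<exists>M>0. \<exists>K\<ge>0. \<forall>x\<ge>0. \<forall>c. \<forall>m\<ge>0. M dvd m \<longrightarrow> K * (x + 1) < c \<longrightarrow>
     P x (c + m) = P x c)"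

lemma fibre_periodic_pred_const: "fibre_periodic_pred (\<lambda>x c. b)"
  unfolding fibre_periodic_pred_def by (auto intro: exI[of _ 1])

lemma fibre_periodic_pred_Not:
  "fibre_periodic_pred P \<Longrightarrow> fibre_periodic_pred (\<lambda>x c. \<not> P x c)"
  unfolding fibre_periodic_pred_def by simp

lemma fibre_periodic_pred_combine:
  assumes "fibre_periodic_pred P" "fibre_periodic_pred Q"
  shows "fibre_periodic_pred (\<lambda>x c. f (P x c) (Q x c))"
proof -
  obtain M K where M: "M > 0" "K \<ge> 0" and P: "\<And>x c m. x \<ge> 0 \<Longrightarrow> m \<ge> 0 \<Longrightarrow> M dvd m \<Longrightarrow>
      K * (x + 1) < c \<Longrightarrow> P x (c + m) = P x c"
    using assms(1) unfolding fibre_periodic_pred_def by blast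
  obtain M' K' where M': "M' > 0" "K' \<ge> 0" and Q: "\<And>x c m. x \<ge> 0 \<Longrightarrow> m \<ge> 0 \<Longrightarrow> M' dvd m \<Longrightarrow>
      K' * (x + 1) < c \<Longrightarrow> Q x (c + m) = Q x c"
    using assms(2) unfolding fibre_periodic_pred_def by blast
  have "f (P x (c + m)) (Q x (c + m)) = f (P x c) (Q x c)"
    if "x \<ge> 0" "m \<ge> 0" "M * M' dvd m" "(K + K') * (x + 1) < c" for x c m
  proof -
    have "M dvd m" "M' dvd m"
      using that(3) by (auto dest: dvd_mult_left dvd_mult_right)
    moreover have "K * (x + 1) \<ge> 0" "K' * (x + 1) \<ge> 0"
      using M M' that(1) by auto
    then have "K * (x + 1) < c" "K' * (x + 1) < c"
      using that(4) by (auto simp: distrib_right)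
    ultimately show ?thesis
      using P Q that(1,2) by simp
  qed
  then show ?thesis
    unfolding fibre_periodic_pred_def using M M'
    by (intro exI[of _ "M * M'"] exI[of _ "K + K'"] conjI) auto
qed

text \<open>Above a steep enough line the term \<open>j * c\<close> outweighs the rest, so the sign
  is that of \<open>j\<close>; if \<open>j = 0\<close>, then \<open>c\<close> has no influence.
  Comparisons with zero depend on the sign alone.\<close>

lemma fibre_periodic_pred_sgn:
  "fibre_periodic_pred (\<lambda>x c. P (sgn (i * x + j * c + d)))"
proof -
  \<comment> \<open>For \<open>x \<ge> 0\<close> this gives
    \<open>\<bar>i * x + d\<bar> \<le> K * (x + 1)\<close>, while
    \<open>\<bar>j * c\<bar> \<ge> c\<close> for an integer \<open>j \<noteq> 0\<close>.\<close>
  define K where "K = \<bar>i\<bar> + \<bar>d\<bar>"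
  have sgn: "sgn (i * x + j * c + d) = sgn j"
    if x: "x \<ge> 0" and c: "K * (x + 1) < c" and j: "j \<noteq> 0" for x c
  proof -
    have "\<bar>i * x + d\<bar> \<le> \<bar>i\<bar> * x + \<bar>d\<bar>"
      using abs_triangle_ineq[of "i * x" d] x by (simp add: abs_mult)
    also have "\<dots> \<le> K * (x + 1)"
      using x by (simp add: K_def algebra_simps)
    also note c
    finally have *: "\<bar>i * x + d\<bar> < c" .
    show ?thesis
    proof (cases "j > 0")
      case True
      then have "1 * c \<le> j * c"
        using * by (intro mult_right_mono) auto
      then show ?thesis
        using * True by simp
    next
      case False
      then have "j * c \<le> - 1 * c"
        using * j by (intro mult_right_mono) auto
      then show ?thesis
        using * False j by simp
    qed
  qed
  have "sgn (i * x + j * (c + m) + d) = sgn (i * x + j * c + d)"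
    if "x \<ge> 0" "m \<ge> 0" "K * (x + 1) < c" for x c m
    using sgn[of x c] sgn[of x "c + m"] that by (cases "j = 0") auto
  moreover have "K \<ge> 0"
    by (simp add: K_def)
  ultimately show ?thesis
    unfolding fibre_periodic_pred_def
    by (intro exI[of _ 1] exI[of _ K] conjI) auto
qed

lemma fibre_periodic_pred_dvd:
  "fibre_periodic_pred (\<lambda>x c. k dvd i * x + j * c + d)"
proof (cases "k = 0")
  \<comment> \<open>\<open>0 dvd t\<close> means \<open>t = 0\<close>, a sign condition;
    \<open>\<bar>k\<bar>\<close> would not be a positive period here.\<close>
  case True
  then show ?thesis
    using fibre_periodic_pred_sgn[of "\<lambda>s. s = 0" i j d] by (simp add: sgn_0_0)
next
  case False
  have "k dvd i * x + j * (c + m) + d \<longleftrightarrow> k dvd i * x + j * c + d" if "\<bar>k\<bar> dvd m" for x c m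
  proof -
    have "i * x + j * (c + m) + d = (i * x + j * c + d) + j * m"
      by (simp add: algebra_simps)
    then show ?thesis
      using that by (simp only: dvd_add_left_iff abs_dvd_iff dvd_mult)
  qed
  then show ?thesis
    unfolding fibre_periodic_pred_def using False
    by (intro exI[of _ "\<bar>k\<bar>"] exI[of _ 0] conjI) auto
qed

text \<open>For \<open>n \<ge> 2\<close> the left-hand side is a junk value of \<open>nth\<close>, but one that does not depend on
  \<open>x\<close> and \<open>c\<close>; hence no bound on the variables of a formula is needed.\<close>

lemma nth_linear: "\<exists>i j d. \<forall>x c :: int. [x, c] ! n = i * x + j * c + d"
proof -
  consider "n = 0" | "n = 1" | l where "n = Suc (Suc l)"
    by (metis One_nat_def not0_implies_Suc)
  then show ?thesis
  proof cases
    case 1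
    then show ?thesis
      by (intro exI[of _ 1] exI[of _ 0]) simp
  next
    case 2
    show ?thesis
      by (rule exI[of _ 0], rule exI[of _ 1], rule exI[of _ 0]) (simp add: 2)
  next
    case (3 l)
    show ?thesis
      by (rule exI[of _ 0], rule exI[of _ 0], rule exI[of _ "[] ! l"]) (simp add: 3)
  qed
qed

lemma Inum_linear: "\<exists>i j d. \<forall>x c. Inum [x, c] t = i * x + j * c + d"
proof (induction t)
  case (C z)
  show ?case
    by (rule exI[of _ 0], rule exI[of _ 0], rule exI[of _ z]) simp
next
  case (Bound n)
  show ?case
    using nth_linear[of n] by simp
next
  case (CN n z t)
  then obtain i' j' d' where "\<And>x c. Inum [x, c] t = i' * x + j' * c + d'"
    by blast
  moreover obtain i j d where "\<And>x c :: int. [x, c] ! n = i * x + j * c + d"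
    using nth_linear[of n] by blast
  ultimately show ?case
    by (intro exI[of _ "z * i + i'"] exI[of _ "z * j + j'"] exI[of _ "z * d + d'"])
      (simp add: algebra_simps)
next
  case (Neg t)
  then obtain i j d where "\<And>x c. Inum [x, c] t = i * x + j * c + d"
    by blast
  then show ?case
    by (intro exI[of _ "- i"] exI[of _ "- j"] exI[of _ "- d"]) simp
next
  case (Add s t)
  obtain i j d where "\<And>x c. Inum [x, c] s = i * x + j * c + d"
    using Add.IH(1) by blast
  moreover obtain i' j' d' where "\<And>x c. Inum [x, c] t = i' * x + j' * c + d'"
    using Add.IH(2) by blast
  ultimately show ?case
    by (intro exI[of _ "i + i'"] exI[of _ "j + j'"] exI[of _ "d + d'"]) (simp add: algebra_simps)
next
  case (Sub s t)
  obtain i j d where "\<And>x c. Inum [x, c] s = i * x + j * c + d"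
    using Sub.IH(1) by blast
  moreover obtain i' j' d' where "\<And>x c. Inum [x, c] t = i' * x + j' * c + d'"
    using Sub.IH(2) by blast
  ultimately show ?case
    by (intro exI[of _ "i - i'"] exI[of _ "j - j'"] exI[of _ "d - d'"]) (simp add: algebra_simps)
next
  case (Mul z t)
  then obtain i j d where "\<And>x c. Inum [x, c] t = i * x + j * c + d"
    by blast
  then show ?case
    by (intro exI[of _ "z * i"] exI[of _ "z * j"] exI[of _ "z * d"]) (simp add: algebra_simps)
qed

lemma fibre_periodic_pred_Inum_sgn: "fibre_periodic_pred (\<lambda>x c. P (sgn (Inum [x, c] t)))"
  using Inum_linear[of t] fibre_periodic_pred_sgn[of P] by auto

lemma fibre_periodic_pred_Inum_dvd: "fibre_periodic_pred (\<lambda>x c. k dvd Inum [x, c] t)"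
  using Inum_linear[of t] fibre_periodic_pred_dvd[of k] by auto

lemma fibre_periodic_pred_qfree:
  "qfree p \<Longrightarrow> fibre_periodic_pred (\<lambda>x c. Ifm bbs [x, c] p)"
proof (induction p)
  case (Lt t)
  show ?case
    using fibre_periodic_pred_Inum_sgn[of "\<lambda>s. s < 0" t] by simp
next
  case (Le t)
  show ?case
    using fibre_periodic_pred_Inum_sgn[of "\<lambda>s. \<not> s > 0" t] by (simp add: not_less)
next
  case (Gt t)
  show ?case
    using fibre_periodic_pred_Inum_sgn[of "\<lambda>s. s > 0" t] by simp
next
  case (Ge t)
  show ?case
    using fibre_periodic_pred_Inum_sgn[of "\<lambda>s. \<not> s < 0" t] by (simp add: not_less)
next
  case (Eq t)
  show ?case
    using fibre_periodic_pred_Inum_sgn[of "\<lambda>s. s = 0" t] by (simp add: sgn_0_0)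
next
  case (NEq t)
  show ?case
    using fibre_periodic_pred_Inum_sgn[of "\<lambda>s. s \<noteq> 0" t] by (simp add: sgn_0_0)
next
  case (And p q)
  then show ?case
    using fibre_periodic_pred_combine[of _ _ "(\<and>)"] by simp
next
  case (Or p q)
  then show ?case
    using fibre_periodic_pred_combine[of _ _ "(\<or>)"] by simp
next
  case (Imp p q)
  then show ?case
    using fibre_periodic_pred_combine[of _ _ "(\<longrightarrow>)"] by simp
next
  case (Iff p q)
  then show ?case
    using fibre_periodic_pred_combine[of _ _ "(=)"] by simp
\<comment> \<open>Left over are constants (\<open>Closed\<close> atoms depend on \<open>bbs\<close>
  only), divisibility atoms and negations; quantified formulas are not \<open>qfree\<close>.\<close>
qed (simp_all add: fibre_periodic_pred_const fibre_periodic_pred_Not fibre_periodic_pred_Inum_dvd)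

section \<open>Presburger definable sets\<close>

primrec num_of_pterm :: "(nat \<Rightarrow> nat) \<Rightarrow> pterm \<Rightarrow> num" where
  "num_of_pterm f (Var n) = Bound (f n)"
| "num_of_pterm f Zero = C 0"
| "num_of_pterm f One = C 1"
| "num_of_pterm f (Plus s t) = Add (num_of_pterm f s) (num_of_pterm f t)"

text \<open>The map \<open>f\<close> sends each variable name to its de Bruijn index; quantifiers, which range over
  the integers in Cooper's formulas, are relativised to the nonnegative ones.\<close>

primrec fm_of_pform :: "(nat \<Rightarrow> nat) \<Rightarrow> pform \<Rightarrow> fm" where
  "fm_of_pform f (Defs.Eq s t) = fm.Eq (Sub (num_of_pterm f s) (num_of_pterm f t))"
| "fm_of_pform f (Less s t) = Lt (Sub (num_of_pterm f s) (num_of_pterm f t))"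
| "fm_of_pform f (Defs.Neg p) = Not (fm_of_pform f p)"
| "fm_of_pform f (Conj p q) = And (fm_of_pform f p) (fm_of_pform f q)"
| "fm_of_pform f (Disj p q) = Or (fm_of_pform f p) (fm_of_pform f q)"
| "fm_of_pform f (Impl p q) = Imp (fm_of_pform f p) (fm_of_pform f q)"
| "fm_of_pform f (Exists n p) =
     E (And (Ge (Bound 0)) (fm_of_pform ((\<lambda>m. Suc (f m))(n := 0)) p))"
| "fm_of_pform f (Forall n p) =
     A (Imp (Ge (Bound 0)) (fm_of_pform ((\<lambda>m. Suc (f m))(n := 0)) p))"

lemma Inum_num_of_pterm:
  "(\<And>n. n \<in> tvars t \<Longrightarrow> bs ! f n = int (e n)) \<Longrightarrow> Inum bs (num_of_pterm f t) = int (tval e t)"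
  by (induction t) auto

text \<open>Agreement is required on the free variables only, so \<open>f\<close> may be arbitrary
  elsewhere. Under a quantifier the bound name takes index 0, which overwrites any earlier index,
  and all others shift by one.\<close>

lemma Ifm_fm_of_pform:
  "(\<And>n. n \<in> free_vars p \<Longrightarrow> bs ! f n = int (e n)) \<Longrightarrow> Ifm bbs bs (fm_of_pform f p) = sat e p"
proof (induction p arbitrary: f bs e)
  case (Exists n p)
  have "Ifm bbs (int a # bs) (fm_of_pform ((\<lambda>m. Suc (f m))(n := 0)) p) = sat (e(n := a)) p" for a
    using Exists.prems by (intro Exists.IH) auto
  \<comment> \<open>The integers \<open>\<ge> 0\<close> are exactly the \<open>int a\<close>, so the
    relativised quantifier ranges over the naturals.\<close>
  then show ?case
    by simp (metis nat_0_le of_nat_0_le_iff)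
next
  case (Forall n p)
  have "Ifm bbs (int a # bs) (fm_of_pform ((\<lambda>m. Suc (f m))(n := 0)) p) = sat (e(n := a)) p" for a
    using Forall.prems by (intro Forall.IH) auto
  then show ?case
    by simp (metis nat_0_le of_nat_0_le_iff)
next
  case (Neg p)
  then show ?case by simp
next
  case (Conj p q)
  have "Ifm bbs bs (fm_of_pform f p) = sat e p" "Ifm bbs bs (fm_of_pform f q) = sat e q"
    using Conj.prems by (auto intro!: Conj.IH)
  then show ?case by simp
next
  case (Disj p q)
  have "Ifm bbs bs (fm_of_pform f p) = sat e p" "Ifm bbs bs (fm_of_pform f q) = sat e q"
    using Disj.prems by (auto intro!: Disj.IH)
  then show ?case by simp
next
  case (Impl p q)
  have "Ifm bbs bs (fm_of_pform f p) = sat e p" "Ifm bbs bs (fm_of_pform f q) = sat e q"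
    using Impl.prems by (auto intro!: Impl.IH)
  then show ?case by simp
qed (simp_all add: Inum_num_of_pterm[where e = e for e])

lemma fibre_periodic_presburger_definable:
  fixes S :: "(nat ^ 2) set"
  assumes "presburger_definable S"
  shows "fibre_periodic S"
proof -
  obtain p and v :: "2 \<Rightarrow> nat" where v: "inj v" "free_vars p \<subseteq> range v"
    and S: "\<And>a e. (\<And>i. e (v i) = a $ i) \<Longrightarrow> a \<in> S \<longleftrightarrow> sat e p"
    using assms unfolding presburger_definable_def by auto
  \<comment> \<open>Indices into the list \<open>[x, c]\<close>. Sending every name other than
    \<open>v 1\<close> to index 1 is harmless, since only \<open>v 1\<close> and \<open>v 2\<close>
    can be free in \<open>p\<close>.\<close>
  define f :: "nat \<Rightarrow> nat" where "f n = (if n = v 1 then 0 else 1)" for n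
  have v12: "v 2 \<noteq> v 1"
    using v(1) by (simp add: inj_eq)
  have range_v: "n = v 1 \<or> n = v 2" if n: "n \<in> free_vars p" for n
  proof -
    obtain i where "n = v i"
      using v(2) n by blast
    then show ?thesis
      using exhaust_2[of i] by auto
  qed
  \<comment> \<open>\<open>pa\<close> is Cooper's quantifier elimination; \<open>mirqe\<close>
    states that its output is equivalent and quantifier-free.\<close>
  define q where "q = pa (fm_of_pform f p)"
  have q: "vector [x, c] \<in> S \<longleftrightarrow> Ifm [] [int x, int c] q" for x c
  proof -
    define e where "e n = (if n = v 1 then x else c)" for n
    have "e (v i) = (vector [x, c] :: nat ^ 2) $ i" for i
      using exhaust_2[of i] v12 by (auto simp: e_def)
    then have "vector [x, c] \<in> S \<longleftrightarrow> sat e p"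
      by (rule S)
    also have "\<dots> \<longleftrightarrow> Ifm [] [int x, int c] (fm_of_pform f p)"
      using range_v v12 by (intro Ifm_fm_of_pform[symmetric]) (auto simp: e_def f_def)
    finally show ?thesis
      unfolding q_def using mirqe by blast
  qed
  have "fibre_periodic_pred (\<lambda>x c. Ifm [] [x, c] q)"
    unfolding q_def using mirqe by (intro fibre_periodic_pred_qfree) blast
  then obtain M K where MK: "M > 0" "K \<ge> 0" and *: "\<And>x c m. x \<ge> 0 \<Longrightarrow> m \<ge> 0 \<Longrightarrow> M dvd m \<Longrightarrow>
      K * (x + 1) < c \<Longrightarrow> Ifm [] [x, c + m] q = Ifm [] [x, c] q"
    unfolding fibre_periodic_pred_def by blast
  have "vector [x, c + m] \<in> S"
    if "nat M dvd m" "nat K * (x + 1) < c" "vector [x, c] \<in> S" for x c m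
  proof -
    have "M dvd int m"
      using that(1) MK(1) by (metis int_dvd_int_iff nat_0_le less_imp_le)
    moreover have "int (nat K * (x + 1)) < int c"
      using that(2) by (simp only: of_nat_less_iff)
    then have "K * (int x + 1) < int c"
      using MK(2) by (simp add: algebra_simps)
    ultimately have "Ifm [] [int x, int c + int m] q = Ifm [] [int x, int c] q"
      by (intro *) auto
    then show ?thesis
      using that(3) q by simp
  qed
  moreover have "nat M > 0"
    using MK(1) by simp
  ultimately show ?thesis
    unfolding fibre_periodic_def by blast
qed

section \<open>The divisibility set\<close>

lemma vector_in_D_iff:
  "vector [x, c] \<in> D y \<longleftrightarrow>
     real x > real y * log 2 3 \<and> c \<ge> 1 \<and> (2 ^ x - 3 ^ y :: int) dvd int c"
  unfolding D_def by (auto simp: vec_eq_iff forall_2)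

lemma exp2_exceeds_line: "\<exists>x\<ge>n. (2::nat) ^ x > k * (x + 1)"
proof -
  have "filterlim (\<lambda>x::nat. 2 ^ x / (real x + 1)) at_top at_top"
    by real_asymp
  then have "eventually (\<lambda>x. 2 ^ x / (real x + 1) > real k) at_top"
    by (simp add: filterlim_at_top_dense)
  then obtain N where N: "\<And>x. x \<ge> N \<Longrightarrow> 2 ^ x / (real x + 1) > real k"
    unfolding eventually_at_top_linorder by blast
  define x where "x = max n N"
  have "real k * (real x + 1) < 2 ^ x"
    using N[of x] by (simp add: x_def field_simps)
  then have "real (k * (x + 1)) < real (2 ^ x)"
    by (simp add: algebra_simps)
  then have "k * (x + 1) < 2 ^ x"
    by (simp only: of_nat_less_iff)
  then show ?thesis
    by (intro exI[of _ x]) (auto simp: x_def)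
qed

lemma not_fibre_periodic_D:
  assumes "y \<ge> 1"
  shows "\<not> fibre_periodic (D y)"
proof
  assume "fibre_periodic (D y)"
  then obtain M K where M: "M > 0" and *: "\<And>x c m. M dvd m \<Longrightarrow> K * (x + 1) < c \<Longrightarrow>
      vector [x, c] \<in> D y \<Longrightarrow> vector [x, c + m] \<in> D y"
    unfolding fibre_periodic_def by blast
  \<comment> \<open>The summands of the slope make \<open>2 ^ x - 3 ^ y\<close> exceed both
    \<open>K * (x + 1)\<close> and \<open>M\<close>; \<open>x \<ge> 2 * y\<close> yields
    \<open>x > y * log 2 3\<close> because \<open>log 2 3 < 2\<close> and
    \<open>y \<ge> 1\<close>.\<close>
  obtain x where x: "x \<ge> 2 * y" "2 ^ x > (K + M + 3 ^ y) * (x + 1)"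
    using exp2_exceeds_line by blast
  define c :: nat where "c = 2 ^ x - 3 ^ y"
  have "(K + M + 3 ^ y) * (x + 1) \<ge> K * (x + 1) + M + 3 ^ y"
    by (simp add: algebra_simps)
  with x(2) have gt: "2 ^ x > K * (x + 1) + M + 3 ^ y"
    by linarith
  then have c: "c > K * (x + 1)" "c > M" "c \<ge> 1"
    unfolding c_def by linarith+
  \<comment> \<open>By \<open>gt\<close> the subtraction on \<open>nat\<close> is not
    truncated.\<close>
  have int_c: "int c = 2 ^ x - 3 ^ y"
    using gt by (simp add: c_def of_nat_diff)
  have "log 2 3 < (2::real)"
    by (simp add: log_less_iff)
  then have "real y * log 2 3 < real y * 2"
    using assms by (intro mult_strict_left_mono) auto
  also have "\<dots> \<le> real x"
    using x(1) by linarith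
  finally have "vector [x, c] \<in> D y"
    using c(3) by (simp add: vector_in_D_iff int_c)
  then have "vector [x, c + M] \<in> D y"
    using * c(1) by simp
  then have "int c dvd int (c + M)"
    by (simp add: vector_in_D_iff int_c[symmetric] del: of_nat_add)
  then have "c dvd M"
    by (metis int_dvd_int_iff dvd_add_right_iff dvd_refl)
  then show False
    using M c(2) by (auto dest: dvd_imp_le)
qed

theorem theorem7p1:
  fixes y :: nat
  assumes "y \<ge> 1"
  shows "\<not> semilinear_set (D y) \<and> \<not> presburger_definable (D y)"
  using not_fibre_periodic_D[OF assms] fibre_periodic_semilinear_set
    fibre_periodic_presburger_definable by blast

end
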